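(* Let $p>2$. The process $\mathcal{T}^{B,p}_{\cdot}:[0,1]\to (C([0,1])_p,\|\cdot\|_p)$ has a continuous modification $\mathcal{S}^{B,p}$ (i.e. a process with continuous sample paths in $(C([0,1])_p,\|\cdot\|_p)$ such that $\mathbb{P}(\mathcal{S}^{B,p}_t=\mathcal{T}^{B,p}_t)=1$ for every $t\in[0,1]$), whose evaluation at time $t\in[0,1]$ is, $\mathbb{P}$-almost surely, $$\mathcal{S}^{B,p}_t=\lim_{u\to t,\ u\in D([0,1]),\ u\ge t}\mathcal{T}^{B,p}_u ,$$ the limit being taken in $(C([0,1])_p,\|\cdot\|_p)$.
   Context: $C_0([-1,1])$ is the space of continuous $f:[-1,1]\to\mathbb{R}$ with $f(-1)=0$, with the sup-norm, equipped with the $\mathbb{P}$-completed Borel $\sigma$-algebra, where $\mathbb{P}$ is Wiener measure (under which the coordinate process $B_t(f)=f(t)$, $t\in[-1,1]$, is a Brownian motion started from $0$ at time $-1$). For a continuous $f:[a,b]\to\mathbb{R}$, $\mathcal{V}_p(f):=\sup_D\big(\sum_{D}|f(t_{i+1})-f(t_i)|^p\big)^{1/p}$, the supremum over all finite dissections $D=\{a=t_0<\dots<t_n=b\}$. $C([a,b])_p$ is the space of continuous $f$ on $[a,b]$ with $\mathcal{V}_p(f)<\infty$, $C_0([a,b])_p$ the subspace of those vanishing at $a$; $\|f\|_p:=\mathcal{V}_p(f)+\|f\|_\infty$. For $h\in[0,1]$, $\mathcal{T}^f_h(u):=f(h-1+u)$, $u\in[0,1]$. For $p>2$, $\mathcal{T}^{B,p}_h(f):=\mathcal{T}^f_h$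 if $f\in C_0([-1,1])_p$ (a set of full $\mathbb{P}$-measure), and $\mathcal{T}^{B,p}_h(f):=0$ otherwise. $D([0,1])=\bigcup_{n}\{k2^{-n}:0\le k\le 2^n\}$ is the set of dyadic rationals in $[0,1]$. *)

theory Defs
  imports "HOL-Probability.Probability"
begin

text \<open>
  A function on \<open>[a, b]\<close> is an extensional function \<^typ>\<open>real \<Rightarrow> real\<close>, i.e. it is \<^term>\<open>undefined\<close>
  outside \<open>[a, b]\<close>. The library metric \<^const>\<open>cfunspace\<close> is the space of bounded continuous
  functions with the supremum metric.
\<close>

definition cont_metric :: "real \<Rightarrow> real \<Rightarrow> (real \<Rightarrow> real) metric" where
  "cont_metric a b = cfunspace (top_of_set {a..b}) euclidean_metric"

definition cont0_metric :: "real \<Rightarrow> real \<Rightarrow> (real \<Rightarrow> real) metric" where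
  "cont0_metric a b = submetric (cont_metric a b) {f. f a = 0}"

definition borel_metric :: "'a metric \<Rightarrow> 'a measure" where
  "borel_metric m = sigma (mspace m) {U. openin (mtopology_of m) U}"

lemma mspace_cont_metric:
  "mspace (cont_metric a b) = {f \<in> extensional {a..b}. continuous_on {a..b} f}"
proof -
  have "Met_TC.mbounded (f ` {a..b})" if "continuous_on {a..b} f" for f :: "real \<Rightarrow> real"
    using compact_imp_bounded[OF compact_continuous_image[OF that compact_Icc]]
    by (auto simp: Met_TC.mbounded_def Met_TC.mcball_def bounded_def subset_iff)
  then show ?thesis
    by (auto simp: cont_metric_def cfunspace_def Met_TC.fspace_def)
qed

lemma mspace_cont0_metric:
  "mspace (cont0_metric a b) = {f \<in> extensional {a..b}. continuous_on {a..b} f \<and> f a = 0}"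
  by (auto simp: cont0_metric_def mspace_cont_metric)

definition dissections :: "real \<Rightarrow> real \<Rightarrow> (nat \<times> (nat \<Rightarrow> real)) set" where
  "dissections a b = {(n, t). t 0 = a \<and> t n = b \<and> (\<forall>i<n. t i < t (Suc i))}"

definition pvar_sum :: "real \<Rightarrow> (real \<Rightarrow> real) \<Rightarrow> nat \<times> (nat \<Rightarrow> real) \<Rightarrow> real" where
  "pvar_sum p f = (\<lambda>(n, t). (\<Sum>i<n. \<bar>f (t (Suc i)) - f (t i)\<bar> powr p) powr (1 / p))"

definition pvar :: "real \<Rightarrow> real \<Rightarrow> real \<Rightarrow> (real \<Rightarrow> real) \<Rightarrow> ennreal" where
  "pvar p a b f = (SUP D\<in>dissections a b. ennreal (pvar_sum p f D))"

definition pvar_space :: "real \<Rightarrow> real \<Rightarrow> real \<Rightarrow> (real \<Rightarrow> real) set" where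
  "pvar_space p a b = {f \<in> mspace (cont_metric a b). pvar p a b f < \<infinity>}"

definition pvar_space0 :: "real \<Rightarrow> real \<Rightarrow> real \<Rightarrow> (real \<Rightarrow> real) set" where
  "pvar_space0 p a b = {f \<in> pvar_space p a b. f a = 0}"

definition pvar_norm :: "real \<Rightarrow> real \<Rightarrow> real \<Rightarrow> (real \<Rightarrow> real) \<Rightarrow> real" where
  "pvar_norm p a b f = enn2real (pvar p a b f) + (SUP u\<in>{a..b}. \<bar>f u\<bar>)"

text \<open>
  \<^const>\<open>Metric_space\<close> asks for nonnegativity and symmetry on the whole type, hence the dummy value
  off the space. The norm only looks at values in \<open>[a, b]\<close>, so the difference need not be made
  extensional.
\<close>

definition pvar_dist :: "real \<Rightarrow> real \<Rightarrow> real \<Rightarrow> (real \<Rightarrow> real) \<Rightarrow> (real \<Rightarrow> real) \<Rightarrow> real" where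
  "pvar_dist p a b f g =
     (if f \<in> pvar_space p a b \<and> g \<in> pvar_space p a b then pvar_norm p a b (\<lambda>u. f u - g u) else 0)"

definition pvar_metric :: "real \<Rightarrow> real \<Rightarrow> real \<Rightarrow> (real \<Rightarrow> real) metric" where
  "pvar_metric p a b = metric (pvar_space p a b, pvar_dist p a b)"

lemma powr_convex_nonneg:
  fixes x y l :: real
  assumes "p \<ge> 1" "x \<ge> 0" "y \<ge> 0" "0 \<le> l" "l \<le> 1"
  shows "(l * x + (1 - l) * y) powr p \<le> l * x powr p + (1 - l) * y powr p"
proof -
  have scale: "(m * z) powr p \<le> m * z powr p" if "0 \<le> m" "m \<le> 1" "z \<ge> 0" for m z :: real
  proof -
    have "m powr p \<le> m powr 1"
      using that assms powr_mono'[of 1 p m] by (cases "m = 0") auto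
    then show ?thesis
      using that by (simp add: powr_mult mult_right_mono)
  qed
  consider "x = 0" | "y = 0" | "x > 0" "y > 0"
    using assms by linarith
  then show ?thesis
  proof cases
    case 1
    then show ?thesis using scale[of "1 - l" y] assms by simp
  next
    case 2
    then show ?thesis using scale[of l x] assms by simp
  next
    case 3
    then show ?thesis
      using convex_onD[OF powr_convex[OF assms(1)], of "1 - l" x y] assms by simp
  qed
qed

lemma Minkowski_sum:
  fixes x y :: "'i \<Rightarrow> real"
  assumes p: "p \<ge> 1" and I: "finite I"
    and x: "\<And>i. i \<in> I \<Longrightarrow> x i \<ge> 0" and y: "\<And>i. i \<in> I \<Longrightarrow> y i \<ge> 0"
  shows "(\<Sum>i\<in>I. (x i + y i) powr p) powr (1 / p)
           \<le> (\<Sum>i\<in>I. x i powr p) powr (1 / p) + (\<Sum>i\<in>I. y i powr p) powr (1 / p)"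
    (is "_ \<le> ?A + ?B")
proof -
  have zero: "\<forall>i\<in>I. z i = 0" if "(\<Sum>i\<in>I. z i powr p) powr (1 / p) = 0" for z :: "'i \<Rightarrow> real"
  proof -
    have "(\<Sum>i\<in>I. z i powr p) = 0" using that by simp
    then show ?thesis using I by (simp add: sum_nonneg_eq_0_iff)
  qed
  have root: "((\<Sum>i\<in>I. z i powr p) powr (1 / p)) powr p = (\<Sum>i\<in>I. z i powr p)" for z :: "'i \<Rightarrow> real"
    using p by (simp add: powr_powr sum_nonneg)
  consider "?A = 0" | "?B = 0" | "?A > 0" "?B > 0"
    by (metis less_eq_real_def powr_ge_zero)
  then show ?thesis
  proof cases
    case 1
    then show ?thesis using zero[OF 1] by simp
  next
    case 2
    then show ?thesis using zero[OF 2] by simp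
  next
    case 3
    define l where "l = ?A / (?A + ?B)"
    have l: "0 \<le> l" "l \<le> 1" and l': "1 - l = ?B / (?A + ?B)"
      using 3 unfolding l_def by (auto simp del: powr_gt_zero simp add: divide_simps)
    have "(\<Sum>i\<in>I. (x i + y i) powr p) / (?A + ?B) powr p
            = (\<Sum>i\<in>I. (l * (x i / ?A) + (1 - l) * (y i / ?B)) powr p)"
    proof -
      have "(x i + y i) powr p / (?A + ?B) powr p = (l * (x i / ?A) + (1 - l) * (y i / ?B)) powr p"
        if "i \<in> I" for i
      proof -
        have "l * (x i / ?A) + (1 - l) * (y i / ?B) = (x i + y i) / (?A + ?B)"
          using 3 unfolding l' by (simp add: l_def add_divide_distrib)
        then show ?thesis
          using x[OF that] y[OF that] 3 by (simp add: powr_divide)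
      qed
      then show ?thesis by (simp add: sum_divide_distrib)
    qed
    also have "\<dots> \<le> (\<Sum>i\<in>I. l * (x i / ?A) powr p + (1 - l) * (y i / ?B) powr p)"
      using 3 x y l p by (intro sum_mono powr_convex_nonneg) auto
    also have "\<dots> = l * ((\<Sum>i\<in>I. x i powr p) / ?A powr p)
                    + (1 - l) * ((\<Sum>i\<in>I. y i powr p) / ?B powr p)"
      using 3 x y
      by (simp add: sum.distrib powr_divide sum_distrib_left sum_divide_distrib)
    also have "\<dots> = 1"
      using 3 by (simp only: root) auto
    finally have le: "(\<Sum>i\<in>I. (x i + y i) powr p) \<le> (?A + ?B) powr p"
      using 3 by (simp add: divide_le_eq)
    have "(\<Sum>i\<in>I. (x i + y i) powr p) powr (1 / p) \<le> ((?A + ?B) powr p) powr (1 / p)"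
      using p by (intro powr_mono2 le sum_nonneg) auto
    then show ?thesis using p 3 by (simp add: powr_powr)
  qed
qed

lemma dissections_nonempty:
  assumes "a \<le> b" shows "dissections a b \<noteq> {}"
proof (cases "a = b")
  case True
  then have "(0, \<lambda>_. a) \<in> dissections a b" by (simp add: dissections_def)
  then show ?thesis by blast
next
  case False
  with assms have "(1, \<lambda>i. if i = 0 then a else b) \<in> dissections a b"
    by (simp add: dissections_def)
  then show ?thesis by blast
qed

lemma dissections_in:
  assumes "(n, t) \<in> dissections a b" "i \<le> n" shows "t i \<in> {a..b}"
proof -
  have t: "t 0 = a" "t n = b" and mono: "\<And>i. i < n \<Longrightarrow> t i \<le> t (Suc i)"
    using assms by (auto simp: dissections_def intro: less_imp_le)
  have "t 0 \<le> t i" using \<open>i \<le> n\<close>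
  proof (induction i)
    case (Suc i)
    then show ?case using mono[of i] by simp
  qed simp
  moreover have "t i \<le> t n" using \<open>i \<le> n\<close>
    by (induction i rule: inc_induct) (auto intro: order_trans mono)
  ultimately show ?thesis using t by simp
qed

lemma pvar_cong:
  assumes "\<And>u. u \<in> {a..b} \<Longrightarrow> f u = g u"
  shows "pvar p a b f = pvar p a b g"
  unfolding pvar_def
proof (intro SUP_cong refl)
  fix D assume "D \<in> dissections a b"
  then obtain n t where D: "D = (n, t)" "(n, t) \<in> dissections a b" by (cases D) auto
  have "f (t i) = g (t i)" if "i \<le> n" for i
    using assms dissections_in[OF D(2) that] by blast
  then show "ennreal (pvar_sum p f D) = ennreal (pvar_sum p g D)"
    by (simp add: D pvar_sum_def)
qed

lemma pvar_sum_nonneg: "0 \<le> pvar_sum p f D"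
  by (simp add: pvar_sum_def case_prod_beta)

lemma pvar_const: "pvar p a b (\<lambda>_. c) = 0"
  by (cases "dissections a b = {}") (simp_all add: pvar_def pvar_sum_def case_prod_beta bot_ennreal)

lemma pvar_diff_commute: "pvar p a b (\<lambda>u. f u - g u) = pvar p a b (\<lambda>u. g u - f u)"
proof -
  have "\<bar>f s - g s - (f r - g r)\<bar> = \<bar>g s - f s - (g r - f r)\<bar>" for r s
    by (simp add: abs_if)
  then show ?thesis by (simp add: pvar_def pvar_sum_def)
qed

lemma pvar_diff_triangle:
  assumes p: "p \<ge> 1"
  shows "pvar p a b (\<lambda>u. f u - h u) \<le> pvar p a b (\<lambda>u. f u - g u) + pvar p a b (\<lambda>u. g u - h u)"
  unfolding pvar_def[of p a b "\<lambda>u. f u - h u"]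
proof (intro SUP_least)
  fix D assume D: "D \<in> dissections a b"
  obtain n t where nt: "D = (n, t)" by (cases D)
  define x where "x i = \<bar>(f (t (Suc i)) - g (t (Suc i))) - (f (t i) - g (t i))\<bar>" for i
  define y where "y i = \<bar>(g (t (Suc i)) - h (t (Suc i))) - (g (t i) - h (t i))\<bar>" for i
  have "pvar_sum p (\<lambda>u. f u - h u) D \<le> (\<Sum>i<n. (x i + y i) powr p) powr (1 / p)"
    unfolding pvar_sum_def nt prod.case using p
    by (intro powr_mono2 sum_mono sum_nonneg) (auto simp: x_def y_def)
  also have "\<dots> \<le> (\<Sum>i<n. x i powr p) powr (1 / p) + (\<Sum>i<n. y i powr p) powr (1 / p)"
    using p by (intro Minkowski_sum) (auto simp: x_def y_def)
  also have "\<dots> = pvar_sum p (\<lambda>u. f u - g u) D + pvar_sum p (\<lambda>u. g u - h u) D"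
    by (simp add: pvar_sum_def nt x_def y_def)
  finally have "ennreal (pvar_sum p (\<lambda>u. f u - h u) D)
      \<le> ennreal (pvar_sum p (\<lambda>u. f u - g u) D) + ennreal (pvar_sum p (\<lambda>u. g u - h u) D)"
    by (simp add: ennreal_leI pvar_sum_nonneg flip: ennreal_plus)
  also have "\<dots> \<le> pvar p a b (\<lambda>u. f u - g u) + pvar p a b (\<lambda>u. g u - h u)"
    unfolding pvar_def by (intro add_mono SUP_upper D)
  finally show "ennreal (pvar_sum p (\<lambda>u. f u - h u) D) \<le> \<dots>" .
qed

lemma pvar_diff_finite:
  assumes "p \<ge> 1" "f \<in> pvar_space p a b" "g \<in> pvar_space p a b"
  shows "pvar p a b (\<lambda>u. f u - g u) < \<infinity>"
proof -
  have "pvar p a b (\<lambda>u. f u - g u) \<le> pvar p a b (\<lambda>u. f u - 0) + pvar p a b (\<lambda>u. 0 - g u)"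
    using pvar_diff_triangle[OF assms(1), of a b f g "\<lambda>_. 0"] .
  also have "\<dots> = pvar p a b f + pvar p a b g"
    using pvar_diff_commute[of p a b g "\<lambda>_. 0"] by simp
  also have "\<dots> < \<infinity>"
    using assms by (simp add: pvar_space_def)
  finally show ?thesis .
qed

lemma Metric_space_pvar:
  assumes p: "p \<ge> 1" and ab: "a \<le> b"
  shows "Metric_space (pvar_space p a b) (pvar_dist p a b)"
proof -
  have bdd: "bdd_above ((\<lambda>u. \<bar>f u - g u\<bar>) ` {a..b})"
    if "f \<in> pvar_space p a b" "g \<in> pvar_space p a b" for f g
  proof -
    have "continuous_on {a..b} (\<lambda>u. \<bar>f u - g u\<bar>)"
      using that by (auto simp: pvar_space_def mspace_cont_metric intro!: continuous_intros)
    then have "compact ((\<lambda>u. \<bar>f u - g u\<bar>) ` {a..b})"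
      using compact_continuous_image by blast
    then show ?thesis
      by (intro bounded_imp_bdd_above compact_imp_bounded)
  qed
  have sup: "\<bar>f u - g u\<bar> \<le> (SUP u\<in>{a..b}. \<bar>f u - g u\<bar>)"
    if "f \<in> pvar_space p a b" "g \<in> pvar_space p a b" "u \<in> {a..b}" for f g u
    using that by (intro cSUP_upper bdd)
  have sup0: "0 \<le> (SUP u\<in>{a..b}. \<bar>f u - g u\<bar>)"
    if "f \<in> pvar_space p a b" "g \<in> pvar_space p a b" for f g
    using sup[OF that, of a] ab by simp
  show ?thesis
  proof
    fix f g
    show "0 \<le> pvar_dist p a b f g"
      using sup0 by (simp add: pvar_dist_def pvar_norm_def)
    show "pvar_dist p a b f g = pvar_dist p a b g f"
      by (auto simp: pvar_dist_def pvar_norm_def pvar_diff_commute[of p a b f g] abs_minus_commute)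
  next
    fix f g assume fg: "f \<in> pvar_space p a b" "g \<in> pvar_space p a b"
    show "pvar_dist p a b f g = 0 \<longleftrightarrow> f = g"
    proof
      assume "pvar_dist p a b f g = 0"
      then have "(SUP u\<in>{a..b}. \<bar>f u - g u\<bar>) = 0"
        using sup0[OF fg] enn2real_nonneg[of "pvar p a b (\<lambda>u. f u - g u)"] fg
        by (simp add: pvar_dist_def pvar_norm_def add_nonneg_eq_0_iff)
      then have "f u = g u" if "u \<in> {a..b}" for u
        using sup[OF fg that] by simp
      then show "f = g"
        using fg by (intro extensionalityI[of _ "{a..b}"]) (auto simp: pvar_space_def mspace_cont_metric)
    next
      assume "f = g"
      then show "pvar_dist p a b f g = 0"
        using ab by (simp add: pvar_dist_def pvar_norm_def pvar_const)
    qed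
  next
    fix f g h
    assume fgh: "f \<in> pvar_space p a b" "g \<in> pvar_space p a b" "h \<in> pvar_space p a b"
    have "(SUP u\<in>{a..b}. \<bar>f u - h u\<bar>) \<le> (SUP u\<in>{a..b}. \<bar>f u - g u\<bar>) + (SUP u\<in>{a..b}. \<bar>g u - h u\<bar>)"
    proof (rule cSUP_least)
      show "{a..b} \<noteq> {}" using ab by simp
      fix u assume u: "u \<in> {a..b}"
      show "\<bar>f u - h u\<bar> \<le> (SUP u\<in>{a..b}. \<bar>f u - g u\<bar>) + (SUP u\<in>{a..b}. \<bar>g u - h u\<bar>)"
        using sup[OF fgh(1,2) u] sup[OF fgh(2,3) u] by linarith
    qed
    moreover have "enn2real (pvar p a b (\<lambda>u. f u - h u))
        \<le> enn2real (pvar p a b (\<lambda>u. f u - g u)) + enn2real (pvar p a b (\<lambda>u. g u - h u))"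
    proof -
      have "enn2real (pvar p a b (\<lambda>u. f u - h u))
          \<le> enn2real (pvar p a b (\<lambda>u. f u - g u) + pvar p a b (\<lambda>u. g u - h u))"
        using pvar_diff_finite[OF p] fgh
        by (intro enn2real_mono pvar_diff_triangle p) auto
      then show ?thesis
        using pvar_diff_finite[OF p] fgh by (simp add: enn2real_plus)
    qed
    ultimately show "pvar_dist p a b f h \<le> pvar_dist p a b f g + pvar_dist p a b g h"
      using fgh by (simp add: pvar_dist_def pvar_norm_def)
  qed
qed

lemma
  assumes "p \<ge> 1" "a \<le> b"
  shows mspace_pvar_metric: "mspace (pvar_metric p a b) = pvar_space p a b"
    and mdist_pvar_metric: "mdist (pvar_metric p a b) = pvar_dist p a b"
  using Metric_space.mspace_metric[OF Metric_space_pvar[OF assms]]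
    Metric_space.mdist_metric[OF Metric_space_pvar[OF assms]]
  by (simp_all add: pvar_metric_def)

definition brownian_motion :: "'w measure \<Rightarrow> real \<Rightarrow> real \<Rightarrow> (real \<Rightarrow> 'w \<Rightarrow> real) \<Rightarrow> bool" where
  "brownian_motion M a b B \<longleftrightarrow>
     prob_space M \<and>
     (\<forall>t\<in>{a..b}. B t \<in> borel_measurable M) \<and>
     (\<forall>\<omega>\<in>space M. continuous_on {a..b} (\<lambda>t. B t \<omega>)) \<and>
     (AE \<omega> in M. B a \<omega> = 0) \<and>
     (\<forall>n t. a \<le> t 0 \<and> t n \<le> b \<and> (\<forall>i<n. t i < t (Suc i)) \<longrightarrow>
        prob_space.indep_vars M (\<lambda>_. borel) (\<lambda>i \<omega>. B (t (Suc i)) \<omega> - B (t i) \<omega>) {..<n}) \<and>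
     (\<forall>s\<in>{a..b}. \<forall>t\<in>{a..b}. s < t \<longrightarrow>
        distributed M lborel (\<lambda>\<omega>. B t \<omega> - B s \<omega>) (normal_density 0 (sqrt (t - s))))"

text \<open>
  Wiener measure is characterised by its defining property; it is the only measure with this
  property because evaluations generate the Borel sigma-algebra.
\<close>

definition wiener_measure :: "real \<Rightarrow> real \<Rightarrow> (real \<Rightarrow> real) measure \<Rightarrow> bool" where
  "wiener_measure a b W \<longleftrightarrow>
     space W = mspace (cont0_metric a b) \<and> sets W = sets (borel_metric (cont0_metric a b)) \<and>
     brownian_motion W a b (\<lambda>t f. f t)"

definition continuous_modification ::
    "'w measure \<Rightarrow> real set \<Rightarrow> 'a metric \<Rightarrow> (real \<Rightarrow> 'w \<Rightarrow> 'a) \<Rightarrow> (real \<Rightarrow> 'w \<Rightarrow> 'a) \<Rightarrow> bool" where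
  "continuous_modification M I m X Y \<longleftrightarrow>
     (\<forall>t\<in>I. Y t \<in> measurable M (borel_metric m)) \<and>
     (\<forall>\<omega>\<in>space M. continuous_map (top_of_set I) (mtopology_of m) (\<lambda>t. Y t \<omega>)) \<and>
     (\<forall>t\<in>I. \<P>(\<omega> in M. Y t \<omega> = X t \<omega>) = 1)"

definition seg :: "real \<Rightarrow> (real \<Rightarrow> real) \<Rightarrow> (real \<Rightarrow> real)" where
  "seg h f = (\<lambda>u\<in>{0..1}. f (h - 1 + u))"

definition seg_process :: "real \<Rightarrow> real \<Rightarrow> (real \<Rightarrow> real) \<Rightarrow> (real \<Rightarrow> real)" where
  "seg_process p h f = (if f \<in> pvar_space0 p (-1) 1 then seg h f else (\<lambda>u\<in>{0..1}. 0))"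

definition dyadics :: "real set" where
  "dyadics = (\<Union>n. {real k / 2 ^ n | k. k \<le> 2 ^ n})"

text \<open>
  The filter \<open>u \<rightarrow> t\<close>, \<open>u \<in> D([0,1])\<close>, \<open>u \<ge> t\<close>. The point \<open>t\<close> itself is not removed (as \<^term>\<open>at t within A\<close>
  would do): for \<open>t = 1\<close> it is the only admissible \<open>u\<close>.
\<close>

definition dyadics_from_above :: "real \<Rightarrow> real filter" where
  "dyadics_from_above t = inf (nhds t) (principal {u \<in> dyadics. u \<ge> t})"

end

theory Submission
  imports Defs
begin

text \<open>
  Fix \<open>1/p < \<alpha> < 1/2\<close>. Almost every Brownian path is \<open>\<alpha>\<close>-Hoelder, and on the set of these paths
  \<open>h \<mapsto> seg h f\<close> is itself continuous in the p-variation norm. The modification is therefore the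
  segment process on that set and the zero path off it; along almost every path its value at \<open>t\<close> is
  a limit along any way of approaching \<open>t\<close> in \<open>[0,1]\<close>, in particular along the dyadics from above.

  Everything about the p-variation norm rests on one interpolation (\<open>pvar_interpolation\<close>): for
  functions with a common Hoelder constant and exponent \<open>\<alpha> > 1/p\<close>, smallness in the sup-norm implies
  smallness in the p-variation norm. It is used twice. First, two segments of one Hoelder path that
  start close to each other are uniformly close by uniform continuity, hence close in p-variation,
  which gives continuity in \<open>h\<close>. Secondly, for fixed \<open>h\<close> the map \<open>f \<mapsto> seg h f\<close>, restricted to paths
  with a given Hoelder constant, is continuous from the sup-norm to the p-variation norm. This
  settles measurability: the p-variation norm is not separable, so Borel measurability does not
  follow from that of the evaluations, but a map that is continuous on each piece of a countable
  measurable cover of the Hoelder paths pulls open sets back to measurable sets.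

  Hoelder continuity of Brownian paths is Kolmogorov's argument. The scaled \<open>2k\<close>-th powers of all
  increments over neighbouring dyadic points have a finite expected sum for large \<open>k\<close>, so almost
  surely they are bounded together (\<open>brownian_motion_AE_dyadic_increments_le\<close>), and for continuous
  functions such a bound propagates from dyadic neighbours to all pairs of points
  (\<open>dyadic_increments_le_imp_holder_on\<close>). Since the dyadic bound involves only countably many
  evaluations, it also provides the measurable cover of the Hoelder paths.
\<close>

section \<open>Hoelder functions and the p-variation norm\<close>

definition holder_on :: "real \<Rightarrow> real \<Rightarrow> real set \<Rightarrow> (real \<Rightarrow> real) \<Rightarrow> bool" where
  "holder_on \<alpha> L A f \<longleftrightarrow> (\<forall>s\<in>A. \<forall>t\<in>A. \<bar>f t - f s\<bar> \<le> L * \<bar>t - s\<bar> powr \<alpha>)"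

lemma holder_onD: "holder_on \<alpha> L A f \<Longrightarrow> s \<in> A \<Longrightarrow> t \<in> A \<Longrightarrow> \<bar>f t - f s\<bar> \<le> L * \<bar>t - s\<bar> powr \<alpha>"
  by (auto simp: holder_on_def)

lemma holder_on_diff:
  assumes "holder_on \<alpha> L A f" "holder_on \<alpha> L' A g"
  shows "holder_on \<alpha> (L + L') A (\<lambda>u. f u - g u)"
  unfolding holder_on_def
proof (intro ballI)
  fix s t assume "s \<in> A" "t \<in> A"
  from holder_onD[OF assms(1) this] holder_onD[OF assms(2) this]
  show "\<bar>f t - g t - (f s - g s)\<bar> \<le> (L + L') * \<bar>t - s\<bar> powr \<alpha>"
    by (simp add: distrib_right)
qed

text \<open>
  Splitting \<open>x\<^sup>p = x\<^bsup>p - 1/\<alpha>\<^esup> x\<^bsup>1/\<alpha>\<^esup>\<close> for an increment \<open>x\<close>, the uniform bound controls the first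
  factor, and the Hoelder bound makes the second one at most a multiple of the length of the
  interval; these lengths add up to \<open>b - a\<close> along every dissection.
\<close>

lemma pvar_interpolation:
  assumes \<alpha>: "\<alpha> > 0" and p: "p > 0" "1 \<le> p * \<alpha>" and L: "L \<ge> 0"
    and hol: "holder_on \<alpha> L {a..b} g"
    and bd: "\<And>s t. s \<in> {a..b} \<Longrightarrow> t \<in> {a..b} \<Longrightarrow> \<bar>g t - g s\<bar> \<le> E"
  shows "pvar p a b g \<le> ennreal ((E powr (p - 1 / \<alpha>) * L powr (1 / \<alpha>) * (b - a)) powr (1 / p))"
  unfolding pvar_def
proof (intro SUP_least ennreal_leI)
  fix D assume "D \<in> dissections a b"
  then obtain n t where D: "D = (n, t)" "(n, t) \<in> dissections a b" by (cases D) auto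
  have "(\<Sum>i<n. \<bar>g (t (Suc i)) - g (t i)\<bar> powr p)
      \<le> (\<Sum>i<n. E powr (p - 1 / \<alpha>) * L powr (1 / \<alpha>) * (t (Suc i) - t i))"
  proof (rule sum_mono)
    fix i assume "i \<in> {..<n}"
    then have i: "t i \<in> {a..b}" "t (Suc i) \<in> {a..b}" "t i < t (Suc i)"
      using dissections_in[OF D(2), of i] dissections_in[OF D(2), of "Suc i"] D(2)
      by (auto simp: dissections_def)
    define x where "x = \<bar>g (t (Suc i)) - g (t i)\<bar>"
    have "x powr p = x powr (p - 1 / \<alpha>) * x powr (1 / \<alpha>)"
      by (simp flip: powr_add)
    also have "\<dots> \<le> E powr (p - 1 / \<alpha>) * (L * \<bar>t (Suc i) - t i\<bar> powr \<alpha>) powr (1 / \<alpha>)"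
      using \<alpha> p bd[OF i(1,2)] holder_onD[OF hol i(1,2)]
      by (intro mult_mono powr_mono2) (auto simp: x_def divide_le_eq)
    also have "\<dots> = E powr (p - 1 / \<alpha>) * L powr (1 / \<alpha>) * (t (Suc i) - t i)"
      using \<alpha> L i(3) by (simp add: powr_mult powr_powr)
    finally show "\<bar>g (t (Suc i)) - g (t i)\<bar> powr p
        \<le> E powr (p - 1 / \<alpha>) * L powr (1 / \<alpha>) * (t (Suc i) - t i)"
      by (simp add: x_def)
  qed
  also have "\<dots> = E powr (p - 1 / \<alpha>) * L powr (1 / \<alpha>) * (b - a)"
    using D(2) by (simp add: sum_distrib_left[symmetric] sum_lessThan_telescope dissections_def)
  finally show "pvar_sum p g D \<le> (E powr (p - 1 / \<alpha>) * L powr (1 / \<alpha>) * (b - a)) powr (1 / p)"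
    using p by (auto simp: D(1) pvar_sum_def intro!: powr_mono2 sum_nonneg)
qed

lemma holder_on_imp_pvar_space:
  assumes \<alpha>: "\<alpha> > 0" and p: "p > 0" "1 \<le> p * \<alpha>" and L: "L \<ge> 0"
    and f: "f \<in> mspace (cont_metric a b)" "holder_on \<alpha> L {a..b} f"
  shows "f \<in> pvar_space p a b"
proof -
  have "\<bar>f t - f s\<bar> \<le> L * (b - a) powr \<alpha>" if st: "s \<in> {a..b}" "t \<in> {a..b}" for s t
  proof -
    have "\<bar>t - s\<bar> powr \<alpha> \<le> (b - a) powr \<alpha>"
      using st \<alpha> by (intro powr_mono2) auto
    then show ?thesis
      using holder_onD[OF f(2) st] L by (meson mult_left_mono order_trans)
  qed
  from pvar_interpolation[OF \<alpha> p L f(2) this]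
  have "pvar p a b f < \<infinity>" by (simp add: le_less_trans)
  with f(1) show ?thesis by (simp add: pvar_space_def)
qed

text \<open>
  In \<open>pvar_interpolation\<close> the uniform bound \<open>E\<close> enters with the exponent \<open>p - 1/\<alpha>\<close>, which is positive
  for \<open>\<alpha> > 1/p\<close>, so the estimate tends to zero with \<open>E\<close>. On functions that share a Hoelder exponent \<open>\<alpha> > 1/p\<close> and a Hoelder constant, uniform convergence
  and convergence in the p-variation norm are the same.
\<close>

lemma holder_uniformly_small_imp_pvar_norm_small:
  assumes \<alpha>: "\<alpha> > 0" and p: "p > 0" "1 < p * \<alpha>" and L: "L \<ge> 0" and ab: "a \<le> b" and \<epsilon>: "\<epsilon> > 0"
  obtains \<delta> where "\<delta> > 0"
    "\<And>g. holder_on \<alpha> L {a..b} g \<Longrightarrow> (\<And>u. u \<in> {a..b} \<Longrightarrow> \<bar>g u\<bar> \<le> \<delta>) \<Longrightarrow> pvar_norm p a b g < \<epsilon>"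
proof -
  define H where "H E = ((2 * E) powr (p - 1 / \<alpha>) * L powr (1 / \<alpha>) * (b - a)) powr (1 / p) + E" for E
  have e: "p - 1 / \<alpha> > 0"
    using \<alpha> p by (simp add: divide_less_eq)
  have "((\<lambda>E. (2 * E) powr (p - 1 / \<alpha>)) \<longlongrightarrow> (2 * 0) powr (p - 1 / \<alpha>)) (at_right (0::real))"
    using e eventually_mono[OF eventually_at_right_less, of 0 "\<lambda>E::real. 0 \<le> 2 * E"]
    by (intro tendsto_powr' tendsto_intros) simp_all
  from tendsto_mult[OF tendsto_mult[OF this tendsto_const] tendsto_const]
  have "((\<lambda>E. (2 * E) powr (p - 1 / \<alpha>) * L powr (1 / \<alpha>) * (b - a)) \<longlongrightarrow> 0) (at_right 0)"
    by simp
  from tendsto_powr'[OF this tendsto_const, of "1 / p"]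
  have "((\<lambda>E. ((2 * E) powr (p - 1 / \<alpha>) * L powr (1 / \<alpha>) * (b - a)) powr (1 / p)) \<longlongrightarrow> 0) (at_right 0)"
    using ab p(1) by simp
  from tendsto_add[OF this tendsto_ident_at] have "(H \<longlongrightarrow> 0) (at_right 0)"
    by (simp add: H_def[abs_def])
  then have "\<forall>\<^sub>F E in at_right 0. H E < \<epsilon>"
    using \<epsilon> by (intro order_tendstoD) auto
  then have "\<forall>\<^sub>F E in at_right 0. H E < \<epsilon> \<and> E > 0"
    by (intro eventually_conj eventually_at_right_less)
  then obtain \<delta> where \<delta>: "H \<delta> < \<epsilon>" "\<delta> > 0"
    using eventually_happens'[of "at_right (0::real)"] by auto
  show thesis
  proof (rule that[OF \<delta>(2)])
    fix g assume g: "holder_on \<alpha> L {a..b} g" "\<And>u. u \<in> {a..b} \<Longrightarrow> \<bar>g u\<bar> \<le> \<delta>"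
    have "\<bar>g t - g s\<bar> \<le> 2 * \<delta>" if "s \<in> {a..b}" "t \<in> {a..b}" for s t
      using g(2)[OF that(1)] g(2)[OF that(2)] by linarith
    from pvar_interpolation[OF \<alpha> p(1) _ L g(1) this] p
    have "enn2real (pvar p a b g) \<le> ((2 * \<delta>) powr (p - 1 / \<alpha>) * L powr (1 / \<alpha>) * (b - a)) powr (1 / p)"
      by (intro enn2real_leI) auto
    moreover have "(SUP u\<in>{a..b}. \<bar>g u\<bar>) \<le> \<delta>"
      using ab g(2) by (intro cSUP_least) auto
    ultimately show "pvar_norm p a b g < \<epsilon>"
      using \<delta>(1) by (simp add: pvar_norm_def H_def)
  qed
qed

section \<open>Hoelder continuity from increments over dyadic grids\<close>

definition dyadic_grid :: "real \<Rightarrow> real \<Rightarrow> nat \<Rightarrow> nat \<Rightarrow> real" where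
  "dyadic_grid a b n j = a + (b - a) * (real j / 2 ^ n)"

text \<open>
  With \<open>q = 2\<^sup>-\<^sup>\<alpha>\<close> this is an \<open>\<alpha>\<close>-Hoelder bound for neighbouring points of each dyadic grid. It
  depends on countably many values of \<open>f\<close> only, so it describes a measurable set of paths.
\<close>

definition dyadic_increments_le :: "real \<Rightarrow> real \<Rightarrow> real \<Rightarrow> real \<Rightarrow> (real \<Rightarrow> real) \<Rightarrow> bool" where
  "dyadic_increments_le q K a b f \<longleftrightarrow>
     (\<forall>n. \<forall>j<2 ^ n. \<bar>f (dyadic_grid a b n (Suc j)) - f (dyadic_grid a b n j)\<bar> \<le> K * q ^ n)"

lemma dyadic_grid_in:
  assumes "a \<le> b" "j \<le> 2 ^ n"
  shows "dyadic_grid a b n j \<in> {a..b}"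
proof -
  have "real j \<le> 2 ^ n"
    using assms(2) by (metis of_nat_le_iff of_nat_numeral of_nat_power)
  then have "real j / 2 ^ n \<le> 1" "real j / 2 ^ n \<ge> 0"
    by auto
  then have "(b - a) * (real j / 2 ^ n) \<le> (b - a) * 1" "(b - a) * (real j / 2 ^ n) \<ge> 0"
    using assms(1) by (intro mult_left_mono; simp) (use assms(1) in simp)
  then show ?thesis by (simp add: dyadic_grid_def)
qed

lemma dyadic_grid_Suc: "dyadic_grid a b (Suc n) (2 * j) = dyadic_grid a b n j"
  by (simp add: dyadic_grid_def)

text \<open>The last point of the \<open>n\<close>-th grid that is at most \<open>t\<close> has this index.\<close>

definition dyadic_index :: "real \<Rightarrow> real \<Rightarrow> nat \<Rightarrow> real \<Rightarrow> nat" where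
  "dyadic_index a b n t = nat \<lfloor>2 ^ n * ((t - a) / (b - a))\<rfloor>"

context
  fixes a b :: real
  assumes ab: "a < b"
begin

lemma dyadic_index_bounds:
  assumes "t \<in> {a..b}"
  shows "real (dyadic_index a b n t) \<le> 2 ^ n * ((t - a) / (b - a))"
    and "2 ^ n * ((t - a) / (b - a)) < real (dyadic_index a b n t) + 1"
    and "dyadic_index a b n t \<le> 2 ^ n"
proof -
  have x: "0 \<le> (t - a) / (b - a)" "(t - a) / (b - a) \<le> 1"
    using assms ab by auto
  then have 0: "0 \<le> 2 ^ n * ((t - a) / (b - a))" by (intro mult_nonneg_nonneg) auto
  then show 1: "real (dyadic_index a b n t) \<le> 2 ^ n * ((t - a) / (b - a))"
    and "2 ^ n * ((t - a) / (b - a)) < real (dyadic_index a b n t) + 1"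
    unfolding dyadic_index_def by linarith+
  have "2 ^ n * ((t - a) / (b - a)) \<le> 2 ^ n * 1"
    using x by (intro mult_left_mono) auto
  with 1 have "real (dyadic_index a b n t) \<le> 2 ^ n" by linarith
  then show "dyadic_index a b n t \<le> 2 ^ n"
    by (metis of_nat_le_iff of_nat_numeral of_nat_power)
qed

lemma dyadic_index_tendsto:
  assumes t: "t \<in> {a..b}"
  shows "(\<lambda>n. dyadic_grid a b n (dyadic_index a b n t)) \<longlonglongrightarrow> t"
proof -
  have le: "\<bar>dyadic_grid a b n (dyadic_index a b n t) - t\<bar> \<le> (b - a) * (1 / 2) ^ n" for n
  proof -
    define x where "x = (t - a) / (b - a)"
    define k where "k = real (dyadic_index a b n t)"
    have k: "k \<le> 2 ^ n * x" "2 ^ n * x < k + 1"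
      using dyadic_index_bounds[OF t, of n] by (auto simp: k_def x_def)
    have "t = a + (b - a) * x" using ab by (simp add: x_def)
    then have "dyadic_grid a b n (dyadic_index a b n t) - t = (b - a) * (k / 2 ^ n - x)"
      by (simp add: dyadic_grid_def k_def algebra_simps)
    moreover have "k / 2 ^ n \<le> x" "x \<le> (k + 1) / 2 ^ n"
      using k by (simp_all add: divide_le_eq le_divide_eq mult.commute)
    then have "\<bar>k / 2 ^ n - x\<bar> \<le> (1 / 2) ^ n"
      by (simp add: add_divide_distrib power_one_over)
    ultimately show ?thesis
      using ab by (simp add: abs_mult mult_left_mono)
  qed
  have lim: "(\<lambda>n. (b - a) * (1 / 2) ^ n) \<longlonglongrightarrow> 0"
    by (intro tendsto_mult_right_zero LIMSEQ_power_zero) auto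
  have "(\<lambda>n. dyadic_grid a b n (dyadic_index a b n t) - t) \<longlonglongrightarrow> 0"
    by (rule Lim_null_comparison[OF _ lim]) (simp add: le)
  then show ?thesis by (simp add: LIM_zero_iff)
qed

text \<open>
  The grid points just below \<open>t\<close> on consecutive levels agree or are neighbours on the finer level.
  Telescoping along the levels from \<open>n\<close> on gives a geometric series.
\<close>

lemma dyadic_increments_le_approx:
  assumes q: "0 < q" "q < 1" and K: "K \<ge> 0"
    and cont: "continuous_on {a..b} f" and inc: "dyadic_increments_le q K a b f"
    and t: "t \<in> {a..b}"
  shows "\<bar>f t - f (dyadic_grid a b n (dyadic_index a b n t))\<bar> \<le> K * q ^ n * (q / (1 - q))"
proof -
  define \<tau> where "\<tau> n = dyadic_grid a b n (dyadic_index a b n t)" for n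
  have step: "\<bar>f (\<tau> (Suc n)) - f (\<tau> n)\<bar> \<le> K * q ^ Suc n" for n
  proof -
    let ?j = "dyadic_index a b n t" and ?j' = "dyadic_index a b (Suc n) t"
    have "real ?j' < 2 * real ?j + 2" "2 * real ?j < real ?j' + 1"
      using dyadic_index_bounds(1,2)[OF t, of n] dyadic_index_bounds(1,2)[OF t, of "Suc n"]
      by (auto simp only: power_Suc mult.assoc)
    then consider "?j' = 2 * ?j" | "?j' = Suc (2 * ?j)" by linarith
    then show ?thesis
    proof cases
      case 1
      then show ?thesis
        using K q by (simp add: \<tau>_def dyadic_grid_Suc)
    next
      case 2
      then have "2 * ?j < 2 ^ Suc n"
        using dyadic_index_bounds(3)[OF t, of "Suc n"] by simp
      with inc have "\<bar>f (dyadic_grid a b (Suc n) (Suc (2 * ?j))) - f (dyadic_grid a b (Suc n) (2 * ?j))\<bar>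
          \<le> K * q ^ Suc n"
        unfolding dyadic_increments_le_def by blast
      then show ?thesis
        unfolding \<tau>_def 2 dyadic_grid_Suc .
    qed
  qed
  have partial: "\<bar>f (\<tau> (n + m)) - f (\<tau> n)\<bar> \<le> K * q ^ n * (q * (1 - q ^ m) / (1 - q))" for m
  proof (induction m)
    case (Suc m)
    have "\<bar>f (\<tau> (n + Suc m)) - f (\<tau> n)\<bar> \<le> K * q ^ n * (q * (1 - q ^ m) / (1 - q)) + K * q ^ Suc (n + m)"
      using Suc step[of "n + m"] by simp
    also have "\<dots> = K * q ^ n * q * ((1 - q ^ m) / (1 - q) + q ^ m)"
      by (simp add: power_add distrib_left)
    also have "(1 - q ^ m) / (1 - q) + q ^ m = (1 - q ^ Suc m) / (1 - q)"
      using q by (simp add: divide_add_eq_iff) (simp add: algebra_simps)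
    finally show ?case by simp
  qed simp
  have bd: "\<bar>f (\<tau> (m + n)) - f (\<tau> n)\<bar> \<le> K * q ^ n * (q / (1 - q))" for m
  proof -
    have "K * q ^ n * (q * (1 - q ^ m) / (1 - q)) \<le> K * q ^ n * (q / (1 - q))"
      using q K by (intro mult_left_mono divide_right_mono) auto
    with partial[of m] show ?thesis
      by (simp only: add.commute[of m n])
  qed
  have "\<tau> m \<in> {a..b}" for m
    using ab dyadic_index_bounds(3)[OF t] by (auto simp: \<tau>_def intro: dyadic_grid_in simp del: atLeastAtMost_iff)
  then have "(\<lambda>m. f (\<tau> m)) \<longlonglongrightarrow> f t"
    using dyadic_index_tendsto[OF t] t cont
    by (intro continuous_on_tendsto_compose[OF cont]) (auto simp: \<tau>_def)
  then have "(\<lambda>m. \<bar>f (\<tau> (m + n)) - f (\<tau> n)\<bar>) \<longlonglongrightarrow> \<bar>f t - f (\<tau> n)\<bar>"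
    by (intro tendsto_intros LIMSEQ_ignore_initial_segment)
  then have "\<bar>f t - f (\<tau> n)\<bar> \<le> K * q ^ n * (q / (1 - q))"
    by (rule LIMSEQ_le_const2) (use bd in blast)
  then show ?thesis by (simp add: \<tau>_def)
qed

text \<open>
  Choose the level \<open>n\<close> whose mesh is comparable with \<open>\<bar>t - s\<bar>\<close>. The grid points below \<open>s\<close> and \<open>t\<close>
  are then equal or neighbours, and moving from \<open>s\<close> and \<open>t\<close> to them costs a multiple of \<open>q\<^sup>n\<close>.
\<close>

lemma dyadic_increments_le_imp_holder_on:
  assumes \<alpha>: "\<alpha> > 0" and q: "q = 2 powr - \<alpha>" and K: "K \<ge> 0"
    and cont: "continuous_on {a..b} f" and inc: "dyadic_increments_le q K a b f"
  shows "holder_on \<alpha> (K * ((1 + q) / (1 - q) * (2 / (b - a)) powr \<alpha>)) {a..b} f"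
proof -
  have q01: "0 < q" "q < 1"
    using \<alpha> by (auto simp: q powr_less_one)
  have main: "\<bar>f t - f s\<bar> \<le> K * ((1 + q) / (1 - q) * (2 / (b - a)) powr \<alpha>) * \<bar>t - s\<bar> powr \<alpha>"
    if st: "s \<in> {a..b}" "t \<in> {a..b}" "s < t" for s t
  proof -
    define d where "d = (t - s) / (b - a)"
    have d: "0 < d" "d \<le> 1" using st ab by (auto simp: d_def)
    obtain n where n: "(1 / 2) ^ Suc n < d" "d \<le> (1 / 2) ^ n"
    proof -
      have ex: "\<exists>m. (1 / 2) ^ m < d"
        using d(1) by (intro real_arch_pow_inv) auto
      define m where "m = (LEAST m. (1 / 2) ^ m < d)"
      have m: "(1 / 2) ^ m < d" using LeastI_ex[OF ex] by (simp add: m_def)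
      with d(2) obtain n where "m = Suc n" by (cases m) auto
      moreover from this have "\<not> (1 / 2) ^ n < d"
        using not_less_Least[of n "\<lambda>m. (1 / 2) ^ m < d"] by (simp add: m_def)
      ultimately show thesis using m that by auto
    qed
    let ?j = "dyadic_index a b n s" and ?k = "dyadic_index a b n t"
    let ?\<sigma> = "dyadic_grid a b n ?j" and ?\<tau> = "dyadic_grid a b n ?k"
    have near: "\<bar>f ?\<tau> - f ?\<sigma>\<bar> \<le> K * q ^ n"
    proof -
      have "2 ^ n * ((t - a) / (b - a)) = 2 ^ n * ((s - a) / (b - a)) + 2 ^ n * d"
        by (simp add: d_def diff_divide_distrib algebra_simps)
      moreover have "2 ^ n * d \<le> 1" "0 \<le> 2 ^ n * d"
        using n(2) d by (simp_all add: power_one_over le_divide_eq mult.commute)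
      ultimately have "real ?k < real ?j + 2" "real ?j < real ?k + 1"
        using dyadic_index_bounds(1,2)[OF st(1), of n] dyadic_index_bounds(1,2)[OF st(2), of n]
        by linarith+
      then consider "?k = ?j" | "?k = Suc ?j" by linarith
      then show ?thesis
      proof cases
        case 1
        then show ?thesis using K q01 by simp
      next
        case 2
        then have "?j < 2 ^ n" using dyadic_index_bounds(3)[OF st(2), of n] by simp
        with inc show ?thesis unfolding dyadic_increments_le_def 2 by blast
      qed
    qed
    have "2 powr \<alpha> * q = 1"
      by (simp add: q powr_minus)
    moreover have "(1 / 2) powr \<alpha> = q"
      by (simp add: q powr_divide powr_minus_divide)
    moreover have "((1 / 2) ^ m) powr \<alpha> = ((1 / 2) powr \<alpha>) ^ m" for m :: nat
    proof (induction m)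
      case (Suc m)
      then show ?case using powr_mult[of "1 / 2" "(1 / 2) ^ m" \<alpha>] by simp
    qed simp
    ultimately have "2 powr \<alpha> * ((1 / 2) ^ Suc n) powr \<alpha> = q ^ n"
      by (metis mult.assoc mult_1_left power_Suc)
    then have "q ^ n = 2 powr \<alpha> * ((1 / 2) ^ Suc n) powr \<alpha>" ..
    also have "\<dots> \<le> 2 powr \<alpha> * d powr \<alpha>"
      using n(1) \<alpha> by (intro mult_left_mono powr_mono2) auto
    also have "\<dots> = (2 / (b - a)) powr \<alpha> * \<bar>t - s\<bar> powr \<alpha>"
      using st ab by (simp add: d_def flip: powr_mult)
    finally have qn: "q ^ n \<le> (2 / (b - a)) powr \<alpha> * \<bar>t - s\<bar> powr \<alpha>" .
    have eq: "(1 + q) / (1 - q) = q / (1 - q) + 1 + q / (1 - q)"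
      using q01 by (simp add: divide_simps)
    have "\<bar>f t - f s\<bar> \<le> \<bar>f t - f ?\<tau>\<bar> + \<bar>f ?\<tau> - f ?\<sigma>\<bar> + \<bar>f s - f ?\<sigma>\<bar>"
      by linarith
    also have "\<dots> \<le> K * q ^ n * (q / (1 - q)) + K * q ^ n + K * q ^ n * (q / (1 - q))"
      using dyadic_increments_le_approx[OF q01 K cont inc st(2)]
        dyadic_increments_le_approx[OF q01 K cont inc st(1)] near by (intro add_mono)
    also have "\<dots> = K * ((1 + q) / (1 - q)) * q ^ n"
      unfolding eq by (simp add: distrib_left distrib_right mult_ac)
    also have "\<dots> \<le> K * ((1 + q) / (1 - q)) * ((2 / (b - a)) powr \<alpha> * \<bar>t - s\<bar> powr \<alpha>)"
      using qn K q01 by (intro mult_left_mono) auto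
    finally show ?thesis by (simp add: mult.assoc)
  qed
  show ?thesis
    unfolding holder_on_def
  proof (intro ballI)
    fix s t assume st: "s \<in> {a..b}" "t \<in> {a..b}"
    consider "s < t" | "t < s" | "s = t" by linarith
    then show "\<bar>f t - f s\<bar> \<le> K * ((1 + q) / (1 - q) * (2 / (b - a)) powr \<alpha>) * \<bar>t - s\<bar> powr \<alpha>"
      using main[of s t] main[of t s] st
      by cases (auto simp: abs_minus_commute)
  qed
qed

end


section \<open>Hoelder continuity of Brownian paths\<close>

lemma brownian_motion_increment_moment:
  assumes bm: "brownian_motion M a b B" and st: "s \<in> {a..b}" "t \<in> {a..b}" "s < t"
  shows "(\<integral>\<^sup>+\<omega>. ennreal ((B t \<omega> - B s \<omega>) ^ (2 * k)) \<partial>M)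
           = ennreal (fact (2 * k) / (2 ^ k * fact k) * (t - s) ^ k)"
proof -
  let ?d = "normal_density 0 (sqrt (t - s))"
  have pos: "sqrt (t - s) > 0" using st by simp
  have "distributed M lborel (\<lambda>\<omega>. B t \<omega> - B s \<omega>) ?d"
    using bm st unfolding brownian_motion_def by blast
  from distributed_nn_integral[OF this, of "\<lambda>x. ennreal (x ^ (2 * k))"]
  have "(\<integral>\<^sup>+\<omega>. ennreal ((B t \<omega> - B s \<omega>) ^ (2 * k)) \<partial>M) = (\<integral>\<^sup>+x. ennreal (?d x) * ennreal (x ^ (2 * k)) \<partial>lborel)"
    by simp
  also have "\<dots> = (\<integral>\<^sup>+x. ennreal (?d x * (x - 0) ^ (2 * k)) \<partial>lborel)"
    by (simp add: ennreal_mult')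
  also have "\<dots> = ennreal (LINT x|lborel. ?d x * (x - 0) ^ (2 * k))"
    by (rule nn_integral_eq_integral[OF integrable.intros[OF normal_moment_even[OF pos]]]) simp
  also have "(LINT x|lborel. ?d x * (x - 0) ^ (2 * k)) = fact (2 * k) / ((2 / (sqrt (t - s))\<^sup>2) ^ k * fact k)"
    by (rule integral_normal_moment_even[OF pos])
  also have "\<dots> = fact (2 * k) / (2 ^ k * fact k) * (t - s) ^ k"
    using st by (simp add: power_divide)
  finally show ?thesis .
qed

text \<open>
  The \<open>2\<^sup>n\<close> increments of level \<open>n\<close>, divided by \<open>q\<^sup>n\<close>, have \<open>2k\<close>-th moments of order
  \<open>2\<^bsup>-nk(1 - 2\<alpha>)\<^esup>\<close>. As soon as \<open>k(1 - 2\<alpha>) > 1\<close>, the sum of these moments over all levels is a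
  convergent geometric series. The random sum of the \<open>2k\<close>-th powers is then almost surely finite, and
  it bounds each of its terms.
\<close>

lemma brownian_motion_AE_dyadic_increments_le:
  assumes bm: "brownian_motion M a b B" and ab: "a < b"
    and \<alpha>: "\<alpha> < 1 / 2" and q: "q = 2 powr - \<alpha>"
  shows "AE \<omega> in M. \<exists>K::nat. dyadic_increments_le q (real K) a b (\<lambda>t. B t \<omega>)"
proof -
  have meas: "B t \<in> borel_measurable M" if "t \<in> {a..b}" for t
    using bm that unfolding brownian_motion_def by blast
  have q0: "q > 0" by (simp add: q)
  obtain k :: nat where k: "1 < real k * (1 - 2 * \<alpha>)"
    using reals_Archimedean3[of "1 - 2 * \<alpha>"] \<alpha> by auto
  then have k0: "k > 0" by (cases k) auto
  define D where "D n j \<omega> = B (dyadic_grid a b n (Suc j)) \<omega> - B (dyadic_grid a b n j) \<omega>" for n j \<omega>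
  define Z where "Z n \<omega> = (\<Sum>j<2 ^ n. ennreal ((D n j \<omega> / q ^ n) ^ (2 * k)))" for n \<omega>
  define c where "c = fact (2 * k) / (2 ^ k * fact k) * (b - a) ^ k"
  define r where "r = 2 * ((1 / 2) ^ k / q ^ (2 * k))"
  have c: "c \<ge> 0" using ab by (simp add: c_def)
  have r: "0 \<le> r" "r < 1"
  proof -
    have "r = 2 powr (1 - real k * (1 - 2 * \<alpha>))"
    proof -
      have "(1 / 2 :: real) ^ k = 2 powr (- real k)"
        by (simp add: powr_minus_divide powr_realpow power_one_over)
      moreover have "q ^ (2 * k) = 2 powr (- \<alpha> * (2 * real k))"
        by (simp add: q powr_power mult.commute)
      ultimately have "r = 2 powr 1 * (2 powr (- real k) / 2 powr (- \<alpha> * (2 * real k)))"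
        by (simp add: r_def)
      also have "\<dots> = 2 powr (1 + (- real k - (- \<alpha> * (2 * real k))))"
        by (simp only: powr_add powr_diff)
      also have "1 + (- real k - (- \<alpha> * (2 * real k))) = 1 - real k * (1 - 2 * \<alpha>)"
        by (simp add: algebra_simps)
      finally show ?thesis .
    qed
    with k show "0 \<le> r" "r < 1" by (auto intro: powr_less_one)
  qed
  have D_meas: "D n j \<in> borel_measurable M" if "j < 2 ^ n" for n j
    unfolding D_def[abs_def]
    using that ab by (intro borel_measurable_diff meas dyadic_grid_in) auto
  have term_meas: "(\<lambda>\<omega>. ennreal ((D n j \<omega> / q ^ n) ^ (2 * k))) \<in> borel_measurable M" if "j < 2 ^ n" for n j
    using D_meas[OF that] by measurable
  then have Z_meas: "Z n \<in> borel_measurable M" for n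
    unfolding Z_def[abs_def] by (intro borel_measurable_sum) simp
  have Z_int: "(\<integral>\<^sup>+\<omega>. Z n \<omega> \<partial>M) = ennreal (c * r ^ n)" for n
  proof -
    have summand: "(\<integral>\<^sup>+\<omega>. ennreal ((D n j \<omega> / q ^ n) ^ (2 * k)) \<partial>M) = ennreal (c * ((1 / 2) ^ k / q ^ (2 * k)) ^ n)"
      if j: "j < 2 ^ n" for j
    proof -
      have grid: "dyadic_grid a b n j \<in> {a..b}" "dyadic_grid a b n (Suc j) \<in> {a..b}"
        "dyadic_grid a b n (Suc j) - dyadic_grid a b n j = (b - a) * (1 / 2) ^ n"
        using j ab by (auto simp del: atLeastAtMost_iff intro!: dyadic_grid_in)
          (simp add: dyadic_grid_def power_one_over field_simps)
      have lt: "dyadic_grid a b n j < dyadic_grid a b n (Suc j)"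
        using grid(3) ab by (simp add: less_iff_diff_less_0[of "dyadic_grid a b n j"] flip: minus_diff_eq[of "dyadic_grid a b n (Suc j)"])
      have "(\<integral>\<^sup>+\<omega>. ennreal ((D n j \<omega> / q ^ n) ^ (2 * k)) \<partial>M)
          = (\<integral>\<^sup>+\<omega>. ennreal (1 / (q ^ n) ^ (2 * k)) * ennreal (D n j \<omega> ^ (2 * k)) \<partial>M)"
        using q0 by (intro nn_integral_cong) (simp add: power_divide flip: ennreal_mult)
      also have "\<dots> = ennreal (1 / (q ^ n) ^ (2 * k)) * (\<integral>\<^sup>+\<omega>. ennreal (D n j \<omega> ^ (2 * k)) \<partial>M)"
        using D_meas[OF j] by (intro nn_integral_cmult) measurable
      also have "\<dots> = ennreal (1 / (q ^ n) ^ (2 * k)) * ennreal (fact (2 * k) / (2 ^ k * fact k) * ((b - a) * (1 / 2) ^ n) ^ k)"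
        using brownian_motion_increment_moment[OF bm grid(1,2) lt, of k] unfolding D_def grid(3) by simp
      also have "\<dots> = ennreal (1 / (q ^ n) ^ (2 * k) * (fact (2 * k) / (2 ^ k * fact k) * ((b - a) * (1 / 2) ^ n) ^ k))"
        using q0 ab by (intro ennreal_mult[symmetric]) auto
      also have "1 / (q ^ n) ^ (2 * k) * (fact (2 * k) / (2 ^ k * fact k) * ((b - a) * (1 / 2) ^ n) ^ k)
          = c * ((1 / 2) ^ k / q ^ (2 * k)) ^ n"
        by (simp add: c_def power_mult_distrib power_divide mult.commute[of n] flip: power_mult)
      finally show ?thesis .
    qed
    have "(\<integral>\<^sup>+\<omega>. Z n \<omega> \<partial>M) = (\<Sum>j<2 ^ n. \<integral>\<^sup>+\<omega>. ennreal ((D n j \<omega> / q ^ n) ^ (2 * k)) \<partial>M)"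
      unfolding Z_def using term_meas by (intro nn_integral_sum) simp
    also have "\<dots> = (\<Sum>j<(2::nat) ^ n. ennreal (c * ((1 / 2) ^ k / q ^ (2 * k)) ^ n))"
      using summand by (intro sum.cong) auto
    also have "\<dots> = ennreal (\<Sum>j<(2::nat) ^ n. c * ((1 / 2) ^ k / q ^ (2 * k)) ^ n)"
      using c q0 by (intro sum_ennreal) auto
    also have "(\<Sum>j<(2::nat) ^ n. c * ((1 / 2) ^ k / q ^ (2 * k)) ^ n) = c * r ^ n"
      unfolding r_def power_mult_distrib[of 2] by simp
    finally show ?thesis .
  qed
  have "(\<integral>\<^sup>+\<omega>. (\<Sum>n. Z n \<omega>) \<partial>M) = (\<Sum>n. ennreal (c * r ^ n))"
    using Z_meas by (subst nn_integral_suminf) (simp_all add: Z_int)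
  also have "\<dots> \<noteq> \<infinity>"
    using r c summable_mult[OF summable_geometric[of r], of c]
    by (subst suminf_ennreal2) auto
  finally have "AE \<omega> in M. (\<Sum>n. Z n \<omega>) \<noteq> \<infinity>"
    using Z_meas by (intro nn_integral_PInf_AE borel_measurable_suminf) auto
  then show ?thesis
  proof (rule eventually_mono)
    fix \<omega> assume fin: "(\<Sum>n. Z n \<omega>) \<noteq> \<infinity>"
    define R where "R = enn2real (\<Sum>n. Z n \<omega>)"
    have R: "(\<Sum>n. Z n \<omega>) = ennreal R" "R \<ge> 0"
      using fin by (auto simp: R_def less_top)
    obtain K :: nat where K: "max 1 R \<le> real K"
      using real_arch_simple by blast
    have "\<bar>D n j \<omega>\<bar> \<le> real K * q ^ n" if j: "j < 2 ^ n" for n j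
    proof -
      define x where "x = \<bar>D n j \<omega> / q ^ n\<bar>"
      have "ennreal ((D n j \<omega> / q ^ n) ^ (2 * k)) \<le> Z n \<omega>"
        unfolding Z_def using j
        by (intro member_le_sum[of j "{..<2 ^ n}" "\<lambda>j. ennreal ((D n j \<omega> / q ^ n) ^ (2 * k))"]) auto
      also have "\<dots> \<le> (\<Sum>n. Z n \<omega>)"
        using sum_le_suminf[of "\<lambda>n. Z n \<omega>" "{n}"] by simp
      finally have x: "x ^ (2 * k) \<le> R"
        using R by (simp add: x_def power_even_abs del: abs_divide)
      have "x \<le> max 1 R"
      proof (cases "x \<le> 1")
        case False
        then have "x \<le> x ^ (2 * k)"
          using k0 by (intro self_le_power) auto
        with x show ?thesis by simp
      qed simp
      also note K
      finally have "x \<le> real K" .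
      then show ?thesis
        using q0 by (simp add: x_def abs_divide divide_le_eq)
    qed
    then show "\<exists>K::nat. dyadic_increments_le q (real K) a b (\<lambda>t. B t \<omega>)"
      unfolding dyadic_increments_le_def D_def by blast
  qed
qed


section \<open>Segments of Hoelder paths in the p-variation metric\<close>

text \<open>
  On a family of functions with a common Hoelder constant, continuity into the sup-norm is already
  continuity into the p-variation norm. Differences of two members have twice that constant.
\<close>

lemma continuous_map_into_pvar_metric:
  assumes p: "p \<ge> 1" and \<alpha>: "\<alpha> > 0" "1 < p * \<alpha>" and L: "L \<ge> 0" and ab: "a \<le> b"
    and space: "\<And>x. x \<in> topspace X \<Longrightarrow> F x \<in> pvar_space p a b"
    and hol: "\<And>x. x \<in> topspace X \<Longrightarrow> holder_on \<alpha> L {a..b} (F x)"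
    and unif: "\<And>x \<delta>. x \<in> topspace X \<Longrightarrow> \<delta> > 0 \<Longrightarrow>
      \<exists>U. openin X U \<and> x \<in> U \<and> (\<forall>y\<in>U. \<forall>u\<in>{a..b}. \<bar>F x u - F y u\<bar> \<le> \<delta>)"
  shows "continuous_map X (mtopology_of (pvar_metric p a b)) F"
proof -
  interpret P: Metric_space "pvar_space p a b" "pvar_dist p a b"
    by (rule Metric_space_pvar[OF p ab])
  have "continuous_map X P.mtopology F"
    unfolding P.continuous_map_to_metric
  proof (intro ballI allI impI)
    fix x \<epsilon> assume x: "x \<in> topspace X" and \<epsilon>: "(\<epsilon>::real) > 0"
    obtain \<delta> where \<delta>: "\<delta> > 0" and small:
      "\<And>g. holder_on \<alpha> (L + L) {a..b} g \<Longrightarrow> (\<And>u. u \<in> {a..b} \<Longrightarrow> \<bar>g u\<bar> \<le> \<delta>) \<Longrightarrow> pvar_norm p a b g < \<epsilon>"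
      using holder_uniformly_small_imp_pvar_norm_small[OF \<alpha>(1) _ \<alpha>(2) _ ab \<epsilon>, of "L + L"] p L by auto
    from unif[OF x \<delta>] obtain U where U: "openin X U" "x \<in> U"
      "\<And>y u. y \<in> U \<Longrightarrow> u \<in> {a..b} \<Longrightarrow> \<bar>F x u - F y u\<bar> \<le> \<delta>" by blast
    have "F y \<in> P.mball (F x) \<epsilon>" if y: "y \<in> U" for y
    proof -
      have y': "y \<in> topspace X" using y U(1) openin_subset by blast
      have "pvar_norm p a b (\<lambda>u. F x u - F y u) < \<epsilon>"
        using U(3)[OF y] by (intro small holder_on_diff hol x y')
      then show ?thesis
        using space[OF x] space[OF y'] by (simp add: pvar_dist_def)
    qed
    with U show "\<exists>U. openin X U \<and> x \<in> U \<and> (\<forall>y\<in>U. F y \<in> P.mball (F x) \<epsilon>)" by blast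
  qed
  then show ?thesis
    by (simp add: mtopology_of_def mspace_pvar_metric[OF p ab] mdist_pvar_metric[OF p ab])
qed

lemma holder_on_seg:
  assumes "holder_on \<alpha> L {-1..1} f" "h \<in> {0..1}"
  shows "holder_on \<alpha> L {0..1} (seg h f)"
  unfolding holder_on_def
proof (intro ballI)
  fix s t :: real assume "s \<in> {0..1}" "t \<in> {0..1}"
  then show "\<bar>seg h f t - seg h f s\<bar> \<le> L * \<bar>t - s\<bar> powr \<alpha>"
    using holder_onD[OF assms(1), of "h - 1 + s" "h - 1 + t"] assms(2) by (simp add: seg_def)
qed

lemma seg_in_cont_metric:
  assumes f: "f \<in> mspace (cont0_metric (-1) 1)" and h: "h \<in> {0..1}"
  shows "seg h f \<in> mspace (cont_metric 0 1)"
proof -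
  have "continuous_on {-1..1} f"
    using f by (simp add: mspace_cont0_metric)
  then have "continuous_on {0..1} (\<lambda>u. f (h - 1 + u))"
    by (rule continuous_on_compose2) (use h in \<open>auto intro!: continuous_intros\<close>)
  then have "continuous_on {0..1} (seg h f)"
    by (rule continuous_on_eq) (simp add: seg_def)
  then show ?thesis
    by (simp add: mspace_cont_metric seg_def)
qed

lemma continuous_map_seg_shift:
  assumes p: "p \<ge> 1" and \<alpha>: "\<alpha> > 0" "1 < p * \<alpha>" and L: "L \<ge> 0"
    and f: "f \<in> mspace (cont0_metric (-1) 1)" "holder_on \<alpha> L {-1..1} f"
  shows "continuous_map (top_of_set {0..1}) (mtopology_of (pvar_metric p 0 1)) (\<lambda>h. seg h f)"
proof (rule continuous_map_into_pvar_metric[OF p \<alpha> L])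
  fix h :: real assume "h \<in> topspace (top_of_set {0..1})"
  then have h: "h \<in> {0..1}" by simp
  show hol: "holder_on \<alpha> L {0..1} (seg h f)"
    by (rule holder_on_seg[OF f(2) h])
  show "seg h f \<in> pvar_space p 0 1"
    using p by (intro holder_on_imp_pvar_space[OF \<alpha>(1) _ _ L seg_in_cont_metric[OF f(1) h] hol]) (use \<alpha> in auto)
next
  fix h \<delta> :: real assume "h \<in> topspace (top_of_set {0..1})" and \<delta>: "\<delta> > 0"
  then have h: "h \<in> {0..1}" by simp
  have "uniformly_continuous_on {-1..1} f"
    using f(1) by (intro compact_uniformly_continuous) (auto simp: mspace_cont0_metric)
  then obtain \<eta> where \<eta>: "\<eta> > 0"
    and uc: "\<And>x y. x \<in> {-1..1} \<Longrightarrow> y \<in> {-1..1} \<Longrightarrow> dist y x < \<eta> \<Longrightarrow> dist (f y) (f x) < \<delta>"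
    using \<delta> unfolding uniformly_continuous_on_def by meson
  have "\<bar>seg h f u - seg h' f u\<bar> \<le> \<delta>" if "h' \<in> {0..1} \<inter> ball h \<eta>" "u \<in> {0..1}" for h' u
  proof -
    have "dist (f (h - 1 + u)) (f (h' - 1 + u)) < \<delta>"
      using that h by (intro uc) (simp_all add: dist_real_def)
    with that(2) show ?thesis by (simp add: seg_def dist_real_def)
  qed
  moreover have "openin (top_of_set {0..1}) ({0..1} \<inter> ball h \<eta>)" by (simp add: openin_open_Int)
  moreover have "h \<in> {0..1} \<inter> ball h \<eta>" using h \<eta> by simp
  ultimately show "\<exists>U. openin (top_of_set {0..1}) U \<and> h \<in> U \<and> (\<forall>h'\<in>U. \<forall>u\<in>{0..1}. \<bar>seg h f u - seg h' f u\<bar> \<le> \<delta>)"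
    by blast
qed simp

lemma abs_diff_le_mdist_cont0_metric:
  assumes "f \<in> mspace (cont0_metric a b)" "g \<in> mspace (cont0_metric a b)" "u \<in> {a..b}"
  shows "\<bar>f u - g u\<bar> \<le> mdist (cont0_metric a b) f g"
proof -
  let ?C = "cfunspace (top_of_set {a..b}) euclidean_metric"
  have "mdist euclidean_metric (f u) (g u) \<le> mdist ?C f g"
  proof (rule mdist_cfunspace_imp_mdist_le[OF _ _ order_refl])
    show "f \<in> mspace ?C" "g \<in> mspace ?C" "u \<in> topspace (top_of_set {a..b})"
      using assms unfolding cont0_metric_def cont_metric_def by (simp_all only: mspace_submetric Int_iff topspace_euclidean_subtopology)
  qed
  then show ?thesis
    unfolding cont0_metric_def cont_metric_def by (simp add: dist_real_def)
qed

text \<open>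
  The common Hoelder constant on \<open>A\<close> is essential: on all paths of finite p-variation the map is
  discontinuous for the sup-norm on its domain.
\<close>

lemma continuous_map_seg_path:
  assumes p: "p \<ge> 1" and \<alpha>: "\<alpha> > 0" "1 < p * \<alpha>" and L: "L \<ge> 0"
    and A: "\<And>f. f \<in> A \<Longrightarrow> holder_on \<alpha> L {-1..1} f" and h: "h \<in> {0..1}"
  shows "continuous_map (subtopology (mtopology_of (cont0_metric (-1) 1)) A)
           (mtopology_of (pvar_metric p 0 1)) (seg h)"
proof (rule continuous_map_into_pvar_metric[OF p \<alpha> L])
  interpret C: Metric_space "mspace (cont0_metric (-1) 1)" "mdist (cont0_metric (-1) 1)"
    by (rule Metric_space_mspace_mdist)
  let ?T = "subtopology (mtopology_of (cont0_metric (-1) 1)) A"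
  {
    fix f assume "f \<in> topspace ?T"
    then have f: "f \<in> mspace (cont0_metric (-1) 1)" "f \<in> A" by auto
    show hol: "holder_on \<alpha> L {0..1} (seg h f)"
      by (rule holder_on_seg[OF A[OF f(2)] h])
    show "seg h f \<in> pvar_space p 0 1"
      using p by (intro holder_on_imp_pvar_space[OF \<alpha>(1) _ _ L seg_in_cont_metric[OF f(1) h] hol]) (use \<alpha> in auto)
  next
    fix f and \<delta> :: real assume "f \<in> topspace ?T" and \<delta>: "\<delta> > 0"
    then have f: "f \<in> mspace (cont0_metric (-1) 1)" "f \<in> A" by auto
    let ?U = "C.mball f \<delta> \<inter> A"
    have "\<bar>seg h f u - seg h g u\<bar> \<le> \<delta>" if "g \<in> ?U" "u \<in> {0..1}" for g u
      using abs_diff_le_mdist_cont0_metric[of f "-1" 1 g "h - 1 + u"] that h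
      by (auto simp: seg_def)
    moreover have "openin ?T ?U"
      unfolding mtopology_of_def by (intro openin_subtopology_Int C.openin_mball)
    moreover have "f \<in> ?U" using f \<delta> by simp
    ultimately show "\<exists>U. openin ?T U \<and> f \<in> U \<and> (\<forall>g\<in>U. \<forall>u\<in>{0..1}. \<bar>seg h f u - seg h g u\<bar> \<le> \<delta>)"
      by blast
  }
qed simp

section \<open>Measurability and the modification\<close>

text \<open>
  The preimage of an open set is, on each piece, the trace of an open set of the domain.
\<close>

lemma measurable_borel_metric_piecewise_continuous:
  assumes T: "topspace T = space M" "\<And>U. openin T U \<Longrightarrow> U \<in> sets M"
    and A: "\<And>i::nat. A i \<in> sets M"
    and cont: "\<And>i. continuous_map (subtopology T (A i)) (mtopology_of m) F"
    and c: "c \<in> mspace m"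
  shows "(\<lambda>x. if x \<in> (\<Union>i. A i) then F x else c) \<in> measurable M (borel_metric m)"
proof -
  let ?G = "\<lambda>x. if x \<in> (\<Union>i. A i) then F x else c"
  have AT: "A i \<subseteq> topspace T" for i
    using sets.sets_into_space[OF A] T(1) by simp
  show ?thesis
    unfolding borel_metric_def
  proof (rule measurable_measure_of)
    show "{U. openin (mtopology_of m) U} \<subseteq> Pow (mspace m)"
      using openin_subset[of "mtopology_of m"] by auto
    have "F x \<in> mspace m" if "x \<in> A i" for x i
      using continuous_map_funspace[OF cont[of i]] that AT[of i] by auto
    then show "?G \<in> space M \<rightarrow> mspace m"
      using c by auto
  next
    fix U assume "U \<in> {U. openin (mtopology_of m) U}"
    then have U: "openin (mtopology_of m) U" by simp
    have piece: "{x \<in> A i. F x \<in> U} \<in> sets M" for i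
    proof -
      have "openin (subtopology T (A i)) {x \<in> topspace (subtopology T (A i)). F x \<in> U}"
        using cont U by (rule openin_continuous_map_preimage)
      also have "topspace (subtopology T (A i)) = A i"
        using AT[of i] by auto
      finally obtain V where "openin T V" "{x \<in> A i. F x \<in> U} = V \<inter> A i"
        by (auto simp: openin_subtopology)
      then show ?thesis using T(2) A by auto
    qed
    have "?G -` U \<inter> space M
        = (\<Union>i. {x \<in> A i. F x \<in> U}) \<union> (if c \<in> U then space M - (\<Union>i. A i) else {})"
      using AT T(1) by (auto split: if_splits)
    also have "\<dots> \<in> sets M"
      using piece A by auto
    finally show "?G -` U \<inter> space M \<in> sets M" .
  qed
qed

lemma dyadics_subset: "dyadics \<subseteq> {0..1}"
proof
  fix u assume "u \<in> dyadics"
  then obtain k n :: nat where u: "u = real k / 2 ^ n" "k \<le> 2 ^ n"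
    by (auto simp: dyadics_def)
  then have "real k \<le> 2 ^ n"
    by (metis of_nat_le_iff of_nat_numeral of_nat_power)
  with u(1) show "u \<in> {0..1}" by simp
qed

lemma limitin_dyadics_from_above:
  assumes cont: "continuous_map (top_of_set {0..1}) T F" and t: "t \<in> {0..1}"
  shows "limitin T F (F t) (dyadics_from_above t)"
  unfolding limitin_def
proof (intro conjI allI impI)
  show "F t \<in> topspace T"
    using continuous_map_funspace[OF cont] t by auto
  fix U assume U: "openin T U \<and> F t \<in> U"
  have "openin (top_of_set {0..1}) {x \<in> {0..1}. F x \<in> U}"
    using openin_continuous_map_preimage[OF cont, of U] U by simp
  then obtain V where V: "open V" "{x \<in> {0..1}. F x \<in> U} = {0..1} \<inter> V"
    by (auto simp: openin_open)
  then have "t \<in> V" using U t by auto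
  then have "eventually (\<lambda>u. u \<in> V) (nhds t)"
    using V(1) by (rule eventually_nhds_in_open[rotated])
  then show "\<forall>\<^sub>F u in dyadics_from_above t. F u \<in> U"
    unfolding dyadics_from_above_def eventually_inf_principal
    using V(2) dyadics_subset by (auto elim!: eventually_mono)
qed

theorem corollary26:
  fixes p :: real and W :: "(real \<Rightarrow> real) measure"
  assumes "p > 2" and "wiener_measure (-1) 1 W"
  shows "\<exists>S. continuous_modification (completion W) {0..1} (pvar_metric p 0 1) (seg_process p) S \<and>
    (\<forall>t\<in>{0..1}. AE f in completion W.
       limitin (mtopology_of (pvar_metric p 0 1)) (\<lambda>u. seg_process p u f) (S t f)
         (dyadics_from_above t))"
proof -
  from assms(2) have spW: "space W = mspace (cont0_metric (-1) 1)"
    and setsW: "sets W = sets (borel_metric (cont0_metric (-1) 1))"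
    and bm: "brownian_motion W (-1) 1 (\<lambda>t f. f t)"
    by (auto simp: wiener_measure_def)
  interpret W: prob_space W using bm by (simp add: brownian_motion_def)
  interpret CW: prob_space "completion W" by (rule W.prob_space_completion)
  let ?P = "mtopology_of (pvar_metric p 0 1)"
  have p1: "p \<ge> 1" using assms(1) by simp
  obtain \<alpha> where \<alpha>: "1 / p < \<alpha>" "\<alpha> < 1 / 2"
    using dense[of "1 / p" "1 / 2"] assms(1) by (auto simp: field_simps)
  have "0 < 1 / p" using assms(1) by simp
  with \<alpha>(1) have \<alpha>0: "\<alpha> > 0" by linarith
  have p\<alpha>: "1 < p * \<alpha>" using \<alpha>(1) assms(1) by (simp add: field_simps)
  define q where "q = 2 powr - \<alpha>"
  \<comment> \<open>the Hoelder constant that a dyadic bound \<open>K\<close> gives on \<open>[-1, 1]\<close>\<close>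
  define L where "L K = real K * ((1 + q) / (1 - q) * (2 / (1 - (-1))) powr \<alpha>)" for K :: nat
  define A where "A K = {f \<in> space W. dyadic_increments_le q (real K) (-1) 1 f}" for K :: nat
  define S where "S t f = (if f \<in> (\<Union>K. A K) then seg t f else (\<lambda>u\<in>{0..1}. 0))" for t f
  have q: "0 < q" "q < 1" using \<alpha>0 by (auto simp: q_def powr_less_one)
  have L: "L K \<ge> 0" for K using q by (simp add: L_def)
  have A_path: "f \<in> mspace (cont0_metric (-1) 1)" if "f \<in> A K" for f K
    using that by (simp add: A_def spW)
  have A_holder: "holder_on \<alpha> (L K) {-1..1} f" if f: "f \<in> A K" for f K
    unfolding L_def
    by (rule dyadic_increments_le_imp_holder_on[OF _ \<alpha>0 q_def])
      (use f A_path[OF f] in \<open>auto simp: A_def mspace_cont0_metric\<close>)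
  have eval: "(\<lambda>f. f t) \<in> borel_measurable W" if "t \<in> {-1..1}" for t
    using bm that unfolding brownian_motion_def by blast
  have A_sets: "A K \<in> sets W" for K
  proof -
    have "{f \<in> space W. j < 2 ^ n \<longrightarrow>
        \<bar>f (dyadic_grid (-1) 1 n (Suc j)) - f (dyadic_grid (-1) 1 n j)\<bar> \<le> real K * q ^ n} \<in> sets W" for n j
    proof (cases "j < 2 ^ n")
      case True
      have "dyadic_grid (-1) 1 n (Suc j) \<in> {-1..1}" "dyadic_grid (-1) 1 n j \<in> {-1..1}"
        using True by (auto simp del: atLeastAtMost_iff intro!: dyadic_grid_in)
      from eval[OF this(1)] eval[OF this(2)] True show ?thesis by simp
    qed simp
    then show ?thesis
      unfolding A_def dyadic_increments_le_def
      by (intro sets.sets_Collect_countable_All)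
  qed
  have zero: "(\<lambda>u\<in>{0..1}. 0) \<in> mspace (pvar_metric p 0 1)"
  proof -
    have "continuous_on {0..1} (\<lambda>u\<in>{0..1}. 0 :: real)"
      by (rule continuous_on_eq[OF continuous_on_const[of _ 0]]) simp
    then have "(\<lambda>u\<in>{0..1}. 0 :: real) \<in> mspace (cont_metric 0 1)"
      unfolding mspace_cont_metric by blast
    then show ?thesis
      using pvar_cong[of 0 1 "\<lambda>u\<in>{0..1}. 0" "\<lambda>_. 0" p]
      by (simp add: mspace_pvar_metric[OF p1] pvar_space_def pvar_const)
  qed
  have cont: "continuous_map (top_of_set {0..1}) ?P (\<lambda>t. S t f)" for f
  proof (cases "f \<in> (\<Union>K. A K)")
    case True
    then obtain K where f: "f \<in> A K" by blast
    from True continuous_map_seg_shift[OF p1 \<alpha>0 p\<alpha> L A_path[OF f] A_holder[OF f]]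
    show ?thesis by (simp add: S_def)
  next
    case False
    with zero show ?thesis
      by (simp add: S_def mspace_pvar_metric[OF p1])
  qed
  have meas: "S t \<in> measurable (completion W) (borel_metric (pvar_metric p 0 1))" if t: "t \<in> {0..1}" for t
  proof -
    have "S t \<in> measurable W (borel_metric (pvar_metric p 0 1))"
      unfolding S_def[abs_def]
    proof (rule measurable_borel_metric_piecewise_continuous[where T = "mtopology_of (cont0_metric (-1) 1)"])
      show "U \<in> sets W" if "openin (mtopology_of (cont0_metric (-1) 1)) U" for U
        using that openin_subset[of "mtopology_of (cont0_metric (-1) 1)"]
        unfolding setsW borel_metric_def by (subst sets_measure_of) auto
      show "continuous_map (subtopology (mtopology_of (cont0_metric (-1) 1)) (A i)) ?P (seg t)" for i
        by (rule continuous_map_seg_path[OF p1 \<alpha>0 p\<alpha> L A_holder t])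
      show "(\<lambda>u\<in>{0..1}. 0) \<in> mspace (pvar_metric p 0 1)"
        by (rule zero)
    qed (use A_sets spW in auto)
    then show ?thesis by (rule measurable_completion)
  qed
  have S_eq: "seg_process p t f = S t f" if "f \<in> A K" for t f K
  proof -
    have "f \<in> mspace (cont_metric (-1) 1)" "f (-1) = 0"
      using A_path[OF that] by (auto simp: mspace_cont0_metric mspace_cont_metric)
    moreover have "f \<in> pvar_space p (-1) 1"
      by (rule holder_on_imp_pvar_space[OF \<alpha>0 _ _ L calculation(1) A_holder[OF that]]) (use p1 p\<alpha> in auto)
    ultimately show ?thesis
      using that by (auto simp: seg_process_def S_def pvar_space0_def)
  qed
  have "AE f in W. \<exists>K. f \<in> A K"
    using brownian_motion_AE_dyadic_increments_le[OF bm _ \<alpha>(2) q_def] by (auto simp: A_def)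
  then have AE_A: "AE f in completion W. \<exists>K. f \<in> A K"
    by (rule AE_completion)
  have "\<P>(f in completion W. S t f = seg_process p t f) = 1" for t
  proof -
    have eq: "AE f in completion W. S t f = seg_process p t f"
      using AE_A by (rule eventually_mono) (auto simp: S_eq)
    \<comment> \<open>The exceptional set is a null set, hence measurable because the measure is complete.\<close>
    then have "Measurable.pred (completion W) (\<lambda>f. \<not> S t f \<noteq> seg_process p t f)"
      by (intro pred_intros_logic(2) sets_completion_AE) (simp add: AE_completion_iff)
    with eq show ?thesis
      by (subst CW.prob_Collect_eq_1) (auto simp: pred_def)
  qed
  moreover have "AE f in completion W. limitin ?P (\<lambda>u. seg_process p u f) (S t f) (dyadics_from_above t)"
    if t: "t \<in> {0..1}" for t
    using AE_A
  proof (rule eventually_mono)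
    fix f assume "\<exists>K. f \<in> A K"
    then have "(\<lambda>u. seg_process p u f) = (\<lambda>u. S u f)" by (auto simp: S_eq)
    with limitin_dyadics_from_above[OF cont t]
    show "limitin ?P (\<lambda>u. seg_process p u f) (S t f) (dyadics_from_above t)" by simp
  qed
  ultimately show ?thesis
    using cont meas unfolding continuous_modification_def by blast
qed

end
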